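(* Fix an integer $d\ge 1$. The simplicial Hausdorff distance $\delta$ is an extended metric on the class $\mathbb{X}^d$, where members of $\mathbb{X}^d$ are identified when they are isomorphic. That is, $\delta$ takes values in $[0,\infty]$ and for all $(X,f),(Y,g),(Z,h)\in\mathbb{X}^d$: (1) $\delta((X,f),(Y,g))\ge 0$, and $\delta((X,f),(Y,g))=0$ if and only if $(X,f)\cong(Y,g)$; (2) $\delta((X,f),(Y,g))=\delta((Y,g),(X,f))$; (3) $\delta((X,f),(Z,h))\le \delta((X,f),(Y,g))+\delta((Y,g),(Z,h))$.
   Context: $\mathbb{X}^d$ is the class of pairs $(X,f)$ where $X$ is a finite abstract simplicial complex with vertex set $X_0$ (every vertex is a $0$-simplex of $X$; simplices are nonempty) and $f:X_0\to\mathbb{R}^d$ is an injective function (the measurement function). $d(\cdot,\cdot)$ denotes Euclidean distance in $\mathbb{R}^d$. $\epsilon$-closeness: for $\epsilon>0$, $(X,f)$ is $\epsilon$-close to $(Y,g)$ if for every $k$ and every $k$-simplex $\sigma\in X$ there is a $k$-simplex $\tau\in Y$ such that for every vertex $v\in\sigma$ there is a vertex $w\in\tau$ with $d(f(v),g(w))<\epsilon$. Directed distance: $\vec d((X,f),(Y,g))=\inf\{\epsilon>0:(X,f)\text{ is }\epsilon\text{-close to }(Y,g)\}\in[0,\infty]$, with $\inf\emptyset=+\infty$. Simplicial Hausdorff distance: $\delta((X,f),(Y,g))=\max\{\vec d((X,f),(Y,g)),\vec d((Y,g),(X,f))\}$. Inclusion: an inclusion of $(X,f)$ in $(Y,g)$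 is a map $\phi:X\hookrightarrow Y$ given by an injective vertex map $\phi_0:X_0\to Y_0$ such that for each $k$-simplex $\sigma\in X$ the image $\phi(\sigma)=\phi_0(\sigma)$ is a $k$-simplex of $Y$, and $g\circ\phi_0=f$. The pairs are isomorphic, $(X,f)\cong(Y,g)$, if there is such a $\phi$ that is moreover bijective as a simplicial map (a bijection on vertices and on simplices). *)

theory Defs
  imports "HOL-Analysis.Analysis"
begin

text \<open>
  An abstract simplicial complex is represented by its set of simplices, so that the vertex set
  is the union of the simplices: downward closure makes every such vertex a 0-simplex.
  The empty complex is allowed.
\<close>

definition finite_simplicial_complex :: "'a set set \<Rightarrow> bool" where
  "finite_simplicial_complex X \<longleftrightarrow>
     finite X \<and>
     (\<forall>\<sigma>\<in>X. finite \<sigma> \<and> \<sigma> \<noteq> {}) \<and>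
     (\<forall>\<sigma>\<in>X. \<forall>\<tau>. \<tau> \<noteq> {} \<and> \<tau> \<subseteq> \<sigma> \<longrightarrow> \<tau> \<in> X)"

definition vertices :: "'a set set \<Rightarrow> 'a set" where
  "vertices X = \<Union>X"

definition simplices_of_dim :: "nat \<Rightarrow> 'a set set \<Rightarrow> 'a set set" where
  "simplices_of_dim k X = {\<sigma> \<in> X. card \<sigma> = k + 1}"

text \<open>
  The measurement function is a total function on the type of potential vertices, but only its
  values on the vertex set are ever used. The dimension is \<open>d = CARD('n) \<ge> 1\<close>.
\<close>

type_synonym ('a, 'n) measured = "'a set set \<times> ('a \<Rightarrow> real ^ 'n)"

definition measured_complexes :: "('a, 'n::finite) measured set" where
  "measured_complexes = {(X, f). finite_simplicial_complex X \<and> inj_on f (vertices X)}"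

definition eps_close :: "real \<Rightarrow> ('a, 'n::finite) measured \<Rightarrow> ('b, 'n) measured \<Rightarrow> bool" where
  "eps_close \<epsilon> = (\<lambda>(X, f) (Y, g).
     \<forall>k. \<forall>\<sigma>\<in>simplices_of_dim k X. \<exists>\<tau>\<in>simplices_of_dim k Y.
       \<forall>v\<in>\<sigma>. \<exists>w\<in>\<tau>. dist (f v) (g w) < \<epsilon>)"

text \<open>The infimum is taken in \<^typ>\<open>ereal\<close>, where the infimum of the empty set is \<open>\<infinity>\<close>.\<close>

definition directed_distance :: "('a, 'n::finite) measured \<Rightarrow> ('b, 'n) measured \<Rightarrow> ereal" where
  "directed_distance x y = Inf {ereal \<epsilon> | \<epsilon>. \<epsilon> > 0 \<and> eps_close \<epsilon> x y}"

definition simplicial_hausdorff :: "('a, 'n::finite) measured \<Rightarrow> ('b, 'n) measured \<Rightarrow> ereal" where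
  "simplicial_hausdorff x y = max (directed_distance x y) (directed_distance y x)"

definition inclusion :: "('a \<Rightarrow> 'b) \<Rightarrow> ('a, 'n::finite) measured \<Rightarrow> ('b, 'n) measured \<Rightarrow> bool" where
  "inclusion \<phi> = (\<lambda>(X, f) (Y, g).
     \<phi> ` vertices X \<subseteq> vertices Y \<and> inj_on \<phi> (vertices X) \<and>
     (\<forall>k. \<forall>\<sigma>\<in>simplices_of_dim k X. \<phi> ` \<sigma> \<in> simplices_of_dim k Y) \<and>
     (\<forall>v\<in>vertices X. g (\<phi> v) = f v))"

definition isomorphic :: "('a, 'n::finite) measured \<Rightarrow> ('b, 'n) measured \<Rightarrow> bool" where
  "isomorphic x y \<longleftrightarrow>
     (\<exists>\<phi>. inclusion \<phi> x y \<and>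
        bij_betw \<phi> (vertices (fst x)) (vertices (fst y)) \<and>
        bij_betw (\<lambda>\<sigma>. \<phi> ` \<sigma>) (fst x) (fst y))"

end

theory Submission imports Defs begin

text \<open>
  Since the complexes are finite, for small \<open>\<epsilon>\<close> two measured vertices at distance less than \<open>\<epsilon>\<close>
  have equal measurements. So the directed distance vanishes iff every measured simplex
  \<open>f ` \<sigma>\<close> is a measured simplex of the other complex, where equality of the dimensions and
  injectivity of \<open>f\<close> turn \<open>f ` \<sigma> \<subseteq> g ` \<tau>\<close> into an equality. By injectivity of the measurement
  functions, an isomorphism exists iff the two families of measured simplices coincide.
\<close>

section \<open>Finite complexes with injective measurements\<close>

lemma measured_complexesD:
  assumes "(X, f) \<in> measured_complexes"
  shows "inj_on f (vertices X)" "finite (vertices X)" "\<And>\<sigma>. \<sigma> \<in> X \<Longrightarrow> finite \<sigma>"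
    "\<And>\<sigma>. \<sigma> \<in> X \<Longrightarrow> \<sigma> \<subseteq> vertices X" "\<And>\<sigma>. \<sigma> \<in> X \<Longrightarrow> \<sigma> \<in> simplices_of_dim (card \<sigma> - 1) X"
proof -
  have inj: "inj_on f (vertices X)" and fin: "finite X" and
    ne: "\<And>\<sigma>. \<sigma> \<in> X \<Longrightarrow> finite \<sigma> \<and> \<sigma> \<noteq> {}"
    using assms unfolding measured_complexes_def finite_simplicial_complex_def by simp_all
  show "inj_on f (vertices X)" by (rule inj)
  show "finite (vertices X)"
    unfolding vertices_def using fin ne by (intro finite_Union) simp_all
  show "finite \<sigma>" if "\<sigma> \<in> X" for \<sigma>
    using ne[OF that] by simp
  show "\<sigma> \<subseteq> vertices X" if "\<sigma> \<in> X" for \<sigma>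
    unfolding vertices_def by (rule Union_upper[OF that])
  \<comment> \<open>Nonempty simplices have positive cardinality, so the truncated subtraction loses
    nothing.\<close>
  show "\<sigma> \<in> simplices_of_dim (card \<sigma> - 1) X" if "\<sigma> \<in> X" for \<sigma>
    using ne[OF that] that card_gt_0_iff[of \<sigma>] by (simp add: simplices_of_dim_def)
qed

lemma card_image_simplex:
  assumes "(X, f) \<in> measured_complexes" "\<sigma> \<in> X"
  shows "card (f ` \<sigma>) = card \<sigma>"
  by (rule card_image[OF inj_on_subset[OF measured_complexesD(1)[OF assms(1)]
        measured_complexesD(4)[OF assms]]])

section \<open>Closeness, infima and the triangle inequality\<close>

lemma directed_distance_nonneg: "0 \<le> directed_distance x y"
  unfolding directed_distance_def by (rule Inf_greatest) auto

lemma directed_distance_le: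
  "0 < \<epsilon> \<Longrightarrow> eps_close \<epsilon> x y \<Longrightarrow> directed_distance x y \<le> ereal \<epsilon>"
  unfolding directed_distance_def by (rule Inf_lower) auto

lemma eps_close_mono:
  assumes "eps_close \<epsilon> (X, f) (Y, g)" "\<epsilon> \<le> \<epsilon>'"
  shows "eps_close \<epsilon>' (X, f) (Y, g)"
  unfolding eps_close_def prod.case
proof (intro allI ballI)
  fix k \<sigma> assume "\<sigma> \<in> simplices_of_dim k X"
  then obtain \<tau> where \<tau>: "\<tau> \<in> simplices_of_dim k Y" "\<forall>v\<in>\<sigma>. \<exists>w\<in>\<tau>. dist (f v) (g w) < \<epsilon>"
    using assms(1) unfolding eps_close_def by blast
  have "\<forall>v\<in>\<sigma>. \<exists>w\<in>\<tau>. dist (f v) (g w) < \<epsilon>'"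
  proof
    fix v assume "v \<in> \<sigma>"
    with \<tau>(2) obtain w where "w \<in> \<tau>" "dist (f v) (g w) < \<epsilon>" by blast
    then show "\<exists>w\<in>\<tau>. dist (f v) (g w) < \<epsilon>'" using assms(2) by (intro bexI[of _ w]) simp_all
  qed
  with \<tau>(1) show "\<exists>\<tau>\<in>simplices_of_dim k Y. \<forall>v\<in>\<sigma>. \<exists>w\<in>\<tau>. dist (f v) (g w) < \<epsilon>'" ..
qed

text \<open>The infimum need not be attained, but a strict upper bound leaves room for an admissible
  parameter below it, and closeness is monotone in the parameter.\<close>

lemma eps_close_if_directed_distance_less:
  assumes "directed_distance x y < ereal \<epsilon>"
  shows "eps_close \<epsilon> x y"
proof -
  obtain \<delta> where "eps_close \<delta> x y" "\<delta> < \<epsilon>"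
    using assms unfolding directed_distance_def Inf_less_iff by auto
  then show ?thesis
    using eps_close_mono[of \<delta> "fst x" "snd x" "fst y" "snd y" \<epsilon>] by simp
qed

text \<open>Simplices are matched through \<open>Y\<close> in a fixed dimension \<open>k\<close>,
  and the triangle inequality is applied vertex by vertex.\<close>

lemma eps_close_trans:
  assumes "eps_close \<epsilon> (X, f) (Y, g)" "eps_close \<delta> (Y, g) (Z, h)"
  shows "eps_close (\<epsilon> + \<delta>) (X, f) (Z, h)"
  unfolding eps_close_def prod.case
proof (intro allI ballI)
  fix k \<sigma> assume "\<sigma> \<in> simplices_of_dim k X"
  then obtain \<tau> where \<tau>: "\<tau> \<in> simplices_of_dim k Y" "\<forall>v\<in>\<sigma>. \<exists>w\<in>\<tau>. dist (f v) (g w) < \<epsilon>"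
    using assms(1) unfolding eps_close_def by blast
  then obtain \<rho> where \<rho>: "\<rho> \<in> simplices_of_dim k Z" "\<forall>v\<in>\<tau>. \<exists>w\<in>\<rho>. dist (g v) (h w) < \<delta>"
    using assms(2) unfolding eps_close_def by blast
  have "\<forall>v\<in>\<sigma>. \<exists>w\<in>\<rho>. dist (f v) (h w) < \<epsilon> + \<delta>"
  proof
    fix v assume "v \<in> \<sigma>"
    with \<tau>(2) obtain w where w: "w \<in> \<tau>" "dist (f v) (g w) < \<epsilon>" by blast
    with \<rho>(2) obtain u where "u \<in> \<rho>" "dist (g w) (h u) < \<delta>" by blast
    then show "\<exists>w\<in>\<rho>. dist (f v) (h w) < \<epsilon> + \<delta>"
      using w(2) dist_triangle_less_add[of "f v" "g w" \<epsilon> "h u" \<delta>] by (auto simp: dist_commute)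
  qed
  with \<rho>(1) show "\<exists>\<rho>\<in>simplices_of_dim k Z. \<forall>v\<in>\<sigma>. \<exists>w\<in>\<rho>. dist (f v) (h w) < \<epsilon> + \<delta>" ..
qed

lemma directed_distance_triangle:
  "directed_distance x z \<le> directed_distance x y + directed_distance y z"
proof (cases "directed_distance x y" "directed_distance y z" rule: ereal2_cases)
  case (real_real a b)
  show ?thesis
  proof (rule ereal_le_epsilon2)
    fix e :: real assume "0 < e"
    \<comment> \<open>Each half of the slack \<open>e\<close> lifts the parameter strictly above the
      corresponding infimum \<open>a\<close> or \<open>b\<close>.\<close>
    have "eps_close (a + e/2) x y" "eps_close (b + e/2) y z"
      using real_real \<open>0 < e\<close> by (auto intro!: eps_close_if_directed_distance_less)
    then have "eps_close (a + b + e) x z"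
      using eps_close_trans[of "a + e/2" "fst x" "snd x" "fst y" "snd y" "b + e/2" "fst z" "snd z"]
      by (simp add: algebra_simps)
    moreover have "0 < a + b + e"
      using directed_distance_nonneg[of x y] directed_distance_nonneg[of y z] real_real \<open>0 < e\<close>
      by simp
    ultimately show "directed_distance x z \<le> directed_distance x y + directed_distance y z + ereal e"
      using directed_distance_le real_real by fastforce
  qed
\<comment> \<open>If a summand is not real, nonnegativity rules out \<open>-\<infinity>\<close>, so
  the right-hand side is \<open>\<infinity>\<close>.\<close>
qed (use directed_distance_nonneg[of x y] directed_distance_nonneg[of y z] in auto)

lemma simplicial_hausdorff_triangle:
  "simplicial_hausdorff x z \<le> simplicial_hausdorff x y + simplicial_hausdorff y z"
proof -
  have "directed_distance x z \<le> simplicial_hausdorff x y + simplicial_hausdorff y z"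
    unfolding simplicial_hausdorff_def
    by (intro order_trans[OF directed_distance_triangle[of x z y]] add_mono) auto
  moreover have "directed_distance z x \<le> simplicial_hausdorff x y + simplicial_hausdorff y z"
    unfolding simplicial_hausdorff_def
    \<comment> \<open>The route from \<open>z\<close> to \<open>x\<close> meets the two legs in
      reverse order, each as the second argument of its maximum.\<close>
    by (subst add.commute, intro order_trans[OF directed_distance_triangle[of z x y]] add_mono) auto
  ultimately show ?thesis
    unfolding simplicial_hausdorff_def[of x z] by simp
qed

section \<open>Vanishing of the directed distance\<close>

lemma separating_eps:
  fixes f :: "'a \<Rightarrow> 'c::metric_space"
  assumes "finite A" "finite B"
  obtains \<epsilon> where "0 < \<epsilon>" "\<And>a b. a \<in> A \<Longrightarrow> b \<in> B \<Longrightarrow> dist (f a) (g b) < \<epsilon> \<Longrightarrow> f a = g b"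
proof -
  \<comment> \<open>Finitely many pairs give finitely many positive distances, and the least of them
    separates distinct values. Inserting 1 keeps the minimum meaningful when \<open>D\<close> is
    empty.\<close>
  define D where "D = {r \<in> (\<lambda>(a, b). dist (f a) (g b)) ` (A \<times> B). 0 < r}"
  have D: "finite (insert 1 D)" using assms by (simp add: D_def)
  show thesis
  proof
    show "0 < Min (insert 1 D)" using D by (subst Min_gr_iff) (auto simp: D_def)
    show "f a = g b" if "a \<in> A" "b \<in> B" "dist (f a) (g b) < Min (insert 1 D)" for a b
    proof (rule ccontr)
      assume "f a \<noteq> g b"
      with that have "dist (f a) (g b) \<in> insert 1 D" by (force simp: D_def)
      then show False using Min_le[OF D] that(3) by fastforce
    qed
  qed
qed

text \<open>One direction of the distance controls one inclusion; using the lemma in both directions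
  yields equality of the two families.\<close>

lemma directed_distance_eq_0_iff:
  assumes X: "(X, f) \<in> measured_complexes" and Y: "(Y, g) \<in> measured_complexes"
  shows "directed_distance (X, f) (Y, g) = 0 \<longleftrightarrow> image f ` X \<subseteq> image g ` Y"
proof
  assume 0: "directed_distance (X, f) (Y, g) = 0"
  obtain \<epsilon> where \<epsilon>: "0 < \<epsilon>"
    "\<And>v w. v \<in> vertices X \<Longrightarrow> w \<in> vertices Y \<Longrightarrow> dist (f v) (g w) < \<epsilon> \<Longrightarrow> f v = g w"
    using separating_eps[OF measured_complexesD(2)[OF X] measured_complexesD(2)[OF Y]] by metis
  \<comment> \<open>Distance zero lies below the separating threshold, so closeness holds at a scale
    where it forces equal measurements.\<close>
  have close: "eps_close \<epsilon> (X, f) (Y, g)"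
    using 0 \<epsilon>(1) by (intro eps_close_if_directed_distance_less) simp
  show "image f ` X \<subseteq> image g ` Y"
  proof (rule image_subsetI)
    fix \<sigma> assume \<sigma>: "\<sigma> \<in> X"
    note dim = measured_complexesD(5)[OF X \<sigma>]
    obtain \<tau> where \<tau>: "\<tau> \<in> simplices_of_dim (card \<sigma> - 1) Y"
      "\<forall>v\<in>\<sigma>. \<exists>w\<in>\<tau>. dist (f v) (g w) < \<epsilon>"
      using close dim unfolding eps_close_def by blast
    then have \<tau>Y: "\<tau> \<in> Y" and card: "card \<tau> = card \<sigma>"
      using dim by (auto simp: simplices_of_dim_def)
    have "f ` \<sigma> \<subseteq> g ` \<tau>"
    proof (rule image_subsetI)
      fix v assume "v \<in> \<sigma>"
      moreover then obtain w where "w \<in> \<tau>" "dist (f v) (g w) < \<epsilon>" using \<tau>(2) by blast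
      ultimately show "f v \<in> g ` \<tau>"
        using \<epsilon>(2) measured_complexesD(4)[OF X \<sigma>] measured_complexesD(4)[OF Y \<tau>Y] by blast
    qed
    moreover have "card (f ` \<sigma>) = card (g ` \<tau>)"
      using card card_image_simplex[OF X \<sigma>] card_image_simplex[OF Y \<tau>Y] by simp
    ultimately have "f ` \<sigma> = g ` \<tau>"
      using measured_complexesD(3)[OF Y \<tau>Y] by (intro card_subset_eq) auto
    then show "f ` \<sigma> \<in> image g ` Y" using \<tau>Y by blast
  qed
next
  assume sub: "image f ` X \<subseteq> image g ` Y"
  \<comment> \<open>A simplex with the same measured image matches at distance zero, hence for every
    positive parameter.\<close>
  have "eps_close \<epsilon> (X, f) (Y, g)" if "0 < \<epsilon>" for \<epsilon>
    unfolding eps_close_def prod.case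
  proof (intro allI ballI)
    fix k \<sigma> assume \<sigma>: "\<sigma> \<in> simplices_of_dim k X"
    then have \<sigma>X: "\<sigma> \<in> X" by (simp add: simplices_of_dim_def)
    then have "f ` \<sigma> \<in> image g ` Y" by (intro subsetD[OF sub] imageI)
    then obtain \<tau> where \<tau>: "f ` \<sigma> = g ` \<tau>" "\<tau> \<in> Y" by (rule imageE)
    have "card \<sigma> = card \<tau>"
      using card_image_simplex[OF X \<sigma>X] card_image_simplex[OF Y \<tau>(2)] \<tau>(1) by simp
    then have "\<tau> \<in> simplices_of_dim k Y" using \<sigma> \<tau> by (simp add: simplices_of_dim_def)
    moreover have "\<forall>v\<in>\<sigma>. \<exists>w\<in>\<tau>. dist (f v) (g w) < \<epsilon>"
    proof
      fix v assume "v \<in> \<sigma>"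
      then have "f v \<in> g ` \<tau>" unfolding \<tau>(1)[symmetric] by (rule imageI)
      then obtain w where "f v = g w" "w \<in> \<tau>" by (rule imageE)
      then show "\<exists>w\<in>\<tau>. dist (f v) (g w) < \<epsilon>" using that by (intro bexI[of _ w]) simp_all
    qed
    ultimately show "\<exists>\<tau>\<in>simplices_of_dim k Y. \<forall>v\<in>\<sigma>. \<exists>w\<in>\<tau>. dist (f v) (g w) < \<epsilon>" ..
  qed
  \<comment> \<open>The summand 0 gives the bound the shape that \<open>ereal_le_epsilon2\<close>
    expects.\<close>
  then have "directed_distance (X, f) (Y, g) \<le> 0 + ereal \<epsilon>" if "0 < \<epsilon>" for \<epsilon>
    unfolding add_0 using that by (intro directed_distance_le)
  then have "directed_distance (X, f) (Y, g) \<le> 0" by (rule ereal_le_epsilon2)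
  then show "directed_distance (X, f) (Y, g) = 0"
    using directed_distance_nonneg by (rule antisym)
qed

section \<open>Isomorphism as equality of measured simplices\<close>

lemma isomorphic_iff_image_eq:
  assumes X: "(X, f) \<in> measured_complexes" and Y: "(Y, g) \<in> measured_complexes"
  shows "isomorphic (X, f) (Y, g) \<longleftrightarrow> image f ` X = image g ` Y"
proof
  assume "isomorphic (X, f) (Y, g)"
  then obtain \<phi> where \<phi>: "\<And>v. v \<in> vertices X \<Longrightarrow> g (\<phi> v) = f v" "image \<phi> ` X = Y"
    unfolding isomorphic_def inclusion_def bij_betw_def prod.case fst_conv snd_conv by blast
  have "f ` \<sigma> = g ` \<phi> ` \<sigma>" if "\<sigma> \<in> X" for \<sigma>
    using \<phi>(1) measured_complexesD(4)[OF X that]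
    unfolding image_image by (intro image_cong) auto
  then show "image f ` X = image g ` Y"
    unfolding \<phi>(2)[symmetric] image_image[of "image g"] by (intro image_cong) auto
next
  assume eq: "image f ` X = image g ` Y"
  \<comment> \<open>The condition \<open>g (\<phi> v) = f v\<close> and injectivity of
    \<open>g\<close> leave only one candidate on vertices: \<open>f\<close> followed by the inverse
    of \<open>g\<close>.\<close>
  define \<psi> where "\<psi> = inv_into (vertices Y) g"
  define \<phi> where "\<phi> = \<psi> \<circ> f"
  \<comment> \<open>Taking unions of the two families of measured simplices gives the measured
    vertices, so \<open>\<psi>\<close> is defined on all values of \<open>f\<close>.\<close>
  have vert: "f ` vertices X = g ` vertices Y"
    using arg_cong[OF eq, of Union] by (simp add: vertices_def image_Union)
  have bij_\<psi>: "bij_betw \<psi> (f ` vertices X) (vertices Y)"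
    unfolding \<psi>_def vert
    by (intro bij_betw_inv_into inj_on_imp_bij_betw measured_complexesD(1)[OF Y])
  have bij: "bij_betw \<phi> (vertices X) (vertices Y)"
    unfolding \<phi>_def
    by (rule bij_betw_trans[OF inj_on_imp_bij_betw[OF measured_complexesD(1)[OF X]] bij_\<psi>])
  \<comment> \<open>Inverting \<open>g\<close> recovers a simplex of \<open>Y\<close> from its
    measured image; both inclusions in \<open>surj\<close> rest on this.\<close>
  have \<phi>_image: "\<phi> ` \<sigma> = \<tau>" if "\<tau> \<in> Y" "f ` \<sigma> = g ` \<tau>" for \<sigma> \<tau>
    unfolding \<phi>_def image_comp[symmetric] that(2) \<psi>_def
    by (rule inv_into_image_cancel[OF measured_complexesD(1)[OF Y]
          measured_complexesD(4)[OF Y that(1)]])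
  have surj: "image \<phi> ` X = Y"
  proof (intro set_eqI iffI)
    fix \<rho> assume "\<rho> \<in> image \<phi> ` X"
    then obtain \<sigma> where \<sigma>: "\<rho> = \<phi> ` \<sigma>" "\<sigma> \<in> X" by (rule imageE)
    have "f ` \<sigma> \<in> image g ` Y" unfolding eq[symmetric] using \<sigma>(2) by (rule imageI)
    then obtain \<tau> where "f ` \<sigma> = g ` \<tau>" "\<tau> \<in> Y" by (rule imageE)
    then show "\<rho> \<in> Y" using \<phi>_image \<sigma>(1) by simp
  next
    fix \<tau> assume \<tau>: "\<tau> \<in> Y"
    then have "g ` \<tau> \<in> image f ` X" unfolding eq by (rule imageI)
    then obtain \<sigma> where \<sigma>: "g ` \<tau> = f ` \<sigma>" "\<sigma> \<in> X" by (rule imageE)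
    show "\<tau> \<in> image \<phi> ` X"
      using \<phi>_image[OF \<tau> \<sigma>(1)[symmetric], symmetric] \<sigma>(2) by (rule image_eqI)
  qed
  \<comment> \<open>Injectivity on simplices is inherited from injectivity on their union, the
    vertex set.\<close>
  have bij_simplices: "bij_betw (image \<phi>) X Y"
    using bij_betw_imp_inj_on[OF bij] surj
    unfolding vertices_def by (intro bij_betw_imageI inj_on_image)
  have card: "card (\<phi> ` \<sigma>) = card \<sigma>" if "\<sigma> \<in> X" for \<sigma>
    by (rule card_image[OF inj_on_subset[OF bij_betw_imp_inj_on[OF bij]
            measured_complexesD(4)[OF X that]]])
  have "g (\<phi> v) = f v" if "v \<in> vertices X" for v
    unfolding \<phi>_def \<psi>_def comp_def
    by (rule f_inv_into_f, unfold vert[symmetric], rule imageI, rule that)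
  moreover have "\<phi> ` \<sigma> \<in> simplices_of_dim k Y" if "\<sigma> \<in> simplices_of_dim k X" for \<sigma> k
    using that card bij_betw_apply[OF bij_simplices] by (simp add: simplices_of_dim_def)
  ultimately have "inclusion \<phi> (X, f) (Y, g)"
    using bij_betw_imp_inj_on[OF bij] bij_betw_imp_surj_on[OF bij] by (simp add: inclusion_def)
  then show "isomorphic (X, f) (Y, g)"
    unfolding isomorphic_def fst_conv snd_conv using bij bij_simplices by blast
qed

theorem theorem2p15:
  fixes X :: "'a set set" and f :: "'a \<Rightarrow> real ^ 'n"
    and Y :: "'b set set" and g :: "'b \<Rightarrow> real ^ 'n"
    and Z :: "'c set set" and h :: "'c \<Rightarrow> real ^ 'n"
  assumes "(X, f) \<in> measured_complexes"
    and "(Y, g) \<in> measured_complexes"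
    and "(Z, h) \<in> measured_complexes"
  shows "0 \<le> simplicial_hausdorff (X, f) (Y, g)
     \<and> (simplicial_hausdorff (X, f) (Y, g) = 0 \<longleftrightarrow> isomorphic (X, f) (Y, g))
     \<and> simplicial_hausdorff (X, f) (Y, g) = simplicial_hausdorff (Y, g) (X, f)
     \<and> simplicial_hausdorff (X, f) (Z, h)
         \<le> simplicial_hausdorff (X, f) (Y, g) + simplicial_hausdorff (Y, g) (Z, h)"
proof (intro conjI)
  show "0 \<le> simplicial_hausdorff (X, f) (Y, g)"
    by (simp add: simplicial_hausdorff_def le_max_iff_disj directed_distance_nonneg)
  \<comment> \<open>A maximum of two nonnegative quantities vanishes exactly when both do.\<close>
  have "simplicial_hausdorff (X, f) (Y, g) = 0
      \<longleftrightarrow> directed_distance (X, f) (Y, g) = 0 \<and> directed_distance (Y, g) (X, f) = 0"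
    using directed_distance_nonneg[of "(X, f)" "(Y, g)"] directed_distance_nonneg[of "(Y, g)" "(X, f)"]
    by (auto simp: simplicial_hausdorff_def max_def)
  also have "\<dots> \<longleftrightarrow> isomorphic (X, f) (Y, g)"
    unfolding directed_distance_eq_0_iff[OF assms(1,2)] directed_distance_eq_0_iff[OF assms(2,1)]
      isomorphic_iff_image_eq[OF assms(1,2)] set_eq_subset ..
  finally show "simplicial_hausdorff (X, f) (Y, g) = 0 \<longleftrightarrow> isomorphic (X, f) (Y, g)" .
  show "simplicial_hausdorff (X, f) (Y, g) = simplicial_hausdorff (Y, g) (X, f)"
    by (simp add: simplicial_hausdorff_def max.commute)
  show "simplicial_hausdorff (X, f) (Z, h)
      \<le> simplicial_hausdorff (X, f) (Y, g) + simplicial_hausdorff (Y, g) (Z, h)"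
    by (rule simplicial_hausdorff_triangle)
qed

end
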